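(* For every cardinal number $\alpha\le\mathfrak{c}$: the set $\ell_{\infty}\setminus c$ is $(\alpha,\mathfrak{c})$-spaceable in $\ell_\infty$ if, and only if, $\alpha<\aleph_{0}$; and the set $\ell_{\infty}\setminus c_{0}$ is $(\alpha,\mathfrak{c})$-spaceable in $\ell_\infty$ if, and only if, $\alpha<\aleph_{0}$.
   Context: $\mathbb{K}$ denotes $\mathbb{R}$ or $\mathbb{C}$; $\mathfrak{c}=\operatorname{card}(\mathbb{R})$; dimension means algebraic (Hamel) dimension. $\ell_\infty$ is the Banach space of bounded sequences in $\mathbb{K}$ with the supremum norm, and $c$ and $c_0$ are its subspaces of convergent sequences and of sequences converging to zero. A subset $A$ of a vector space $V$ is $\alpha$-lineable if $A\cup\{0\}$ contains an $\alpha$-dimensional vector subspace of $V$. For cardinals $\alpha\le\beta$ and $V$ endowed with a topology, a non-void subset $A\subset V$ is $(\alpha,\beta)$-spaceable if it is $\alpha$-lineable and for each $\alpha$-dimensional subspace $W_\alpha\subset A\cup\{0\}$ there is a closed $\beta$-dimensional subspace $W_\beta$ of $V$ with $W_\alpha\subset W_\beta\subset A\cup\{0\}$. *)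

theory Defs
  imports "HOL-Analysis.Bounded_Continuous_Function"
begin

unbundle cardinal_syntax

text \<open>
  Cardinals are well-order relations satisfying \<open>Card_order\<close>, compared by \<open>\<le>o\<close>, \<open><o\<close> and \<open>=o\<close> across
  different underlying types. Linear-algebraic notions take the scalar multiplication as an
  argument, so that complex vector spaces are covered as well as real ones.
\<close>

definition subspace_of_dim ::
  "('k::field \<Rightarrow> 'v::ab_group_add \<Rightarrow> 'v) \<Rightarrow> 'c rel \<Rightarrow> 'v set \<Rightarrow> bool" where
  "subspace_of_dim sc \<alpha> W \<longleftrightarrow>
     module.subspace sc W \<and>
     (\<exists>B. \<not> module.dependent sc B \<and> module.span sc B = W \<and> |B| =o \<alpha>)"

definition lineable ::
  "('k::field \<Rightarrow> 'v::ab_group_add \<Rightarrow> 'v) \<Rightarrow> 'c rel \<Rightarrow> 'v set \<Rightarrow> bool" where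
  "lineable sc \<alpha> A \<longleftrightarrow> (\<exists>W. subspace_of_dim sc \<alpha> W \<and> W \<subseteq> A \<union> {0})"

definition spaceable ::
  "('k::field \<Rightarrow> 'v::{ab_group_add, topological_space} \<Rightarrow> 'v) \<Rightarrow> 'c rel \<Rightarrow> 'd rel \<Rightarrow> 'v set \<Rightarrow> bool"
where
  "spaceable sc \<alpha> \<beta> A \<longleftrightarrow>
     \<alpha> \<le>o \<beta> \<and> A \<noteq> {} \<and> lineable sc \<alpha> A \<and>
     (\<forall>W. subspace_of_dim sc \<alpha> W \<and> W \<subseteq> A \<union> {0} \<longrightarrow>
        (\<exists>W'. subspace_of_dim sc \<beta> W' \<and> closed W' \<and> W \<subseteq> W' \<and> W' \<subseteq> A \<union> {0}))"

text \<open>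
  Since \<^typ>\<open>nat\<close> is discrete, every sequence is continuous, so the bounded continuous functions
  on \<^typ>\<open>nat\<close> with the supremum norm are exactly \<open>\<ell>\<^sub>\<infinity>\<close>.
\<close>

type_synonym 'k linf = "nat \<Rightarrow>\<^sub>C 'k"

text \<open>The library only provides multiplication of bounded continuous functions by real scalars.\<close>

definition linf_scale :: "'k::real_normed_field \<Rightarrow> 'k linf \<Rightarrow> 'k linf" where
  "linf_scale a x = Bcontfun (\<lambda>n. a * apply_bcontfun x n)"

lemma apply_linf_scale [simp]: "apply_bcontfun (linf_scale a x) n = a * apply_bcontfun x n"
proof -
  obtain b where b: "\<And>n. norm (apply_bcontfun x n) \<le> b"
    using bounded_apply_bcontfun[of x] unfolding bounded_iff by blast
  have "norm (a * apply_bcontfun x n) \<le> norm a * b" for n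
    by (simp add: norm_mult mult_left_mono b)
  then have "(\<lambda>n. a * apply_bcontfun x n) \<in> bcontfun"
    unfolding bcontfun_def bounded_iff by (auto intro!: exI[of _ "norm a * b"])
  then show ?thesis
    by (simp add: linf_scale_def Bcontfun_inverse)
qed

lemma vector_space_linf_scale: "vector_space linf_scale"
  by unfold_locales (auto intro!: bcontfun_eqI simp: algebra_simps)

lemma linf_scale_real: "(linf_scale :: real \<Rightarrow> real linf \<Rightarrow> real linf) = scaleR"
  by (auto intro!: ext bcontfun_eqI)

definition c_seqs :: "'k::real_normed_field linf set" where
  "c_seqs = {x. convergent (apply_bcontfun x)}"

definition c0_seqs :: "'k::real_normed_field linf set" where
  "c0_seqs = {x. apply_bcontfun x \<longlonglongrightarrow> 0}"

end

theory Submission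
  imports Defs "HOL-Analysis.Abstract_Topology_2"
begin

text \<open>
  Both \<open>c\<close> and \<open>c\<^sub>0\<close> are nonzero subspaces consisting of convergent sequences, and these properties
  of \<open>C\<close> alone decide for which \<open>\<alpha>\<close> the complement of \<open>C\<close> is spaceable (\<open>spaceable_Compl_iff\<close>).

  The tool is a sequence of closed subspaces, the row spaces. Index the positions of a sequence by
  triples \<open>(j, b, i)\<close>; the \<open>j\<close>-th row space consists of the bounded sequences that vanish outside row
  \<open>j\<close> and do not depend on \<open>i\<close>. Each value of such a sequence, and likewise of a sum over finitely many
  rows, is repeated infinitely often, and the value 0 is attained in any further row. Hence such a sum
  converges only if all its summands vanish (\<open>convergent_row_sum_imp_zero\<close>). Each row space
  contains a linearly independent family indexed by the reals, so it has dimension continuum.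

  For finite \<open>\<alpha>\<close>, let \<open>W\<close> be a finite-dimensional space meeting \<open>C\<close> only in 0. If every row
  space met \<open>W + C\<close> in some \<open>w j + y j \<noteq> 0\<close>, the vectors \<open>w j\<close> would be linearly independent: a
  relation between them puts a combination of the \<open>w j + y j\<close> into \<open>C\<close>, which forces its
  coefficients to vanish. As \<open>W\<close> is finite-dimensional, some row space therefore meets \<open>W + C\<close> only
  in 0, and its sum with \<open>W\<close> is the required closed space (\<open>finite_dim_extension\<close>).

  For infinite \<open>\<alpha>\<close>, fix \<open>u \<noteq> 0\<close> in \<open>C\<close> and take independent vectors \<open>s t\<close> of norm at most 1 in one row
  space. The vectors \<open>u + h t \<cdot> s t\<close> with nonzero scalars \<open>h t\<close> span a space meeting \<open>C\<close> only in 0,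
  since modulo \<open>C\<close> they are multiples of the \<open>s t\<close>. If the \<open>h t\<close> accumulate at 0, every closed space
  containing them contains \<open>u\<close>, so no closed extension avoids \<open>C\<close> (\<open>infinite_dim_obstruction\<close>).
\<close>

section \<open>Linear algebra\<close>

text \<open>
  Independence of an indexed family rather than of a set also excludes repetitions, which is what
  carries the cardinality of the index set over to the spanned dimension.
\<close>

lemma (in vector_space) independent_family:
  assumes "\<And>J a. finite J \<Longrightarrow> J \<subseteq> I \<Longrightarrow> (\<Sum>j\<in>J. scale (a j) (w j)) = 0 \<Longrightarrow> \<forall>j\<in>J. a j = 0"
  shows "inj_on w I" and "independent (w ` I)"
proof -
  show inj: "inj_on w I"
  proof (rule inj_onI, rule ccontr)
    fix i j assume ij: "i \<in> I" "j \<in> I" "w i = w j" "i \<noteq> j"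
    \<comment> \<open>A repetition gives the relation \<open>w i - w j = 0\<close>.\<close>
    have "(\<Sum>k\<in>{i, j}. scale (if k = i then 1 else -1) (w k)) = 0"
      using ij by simp
    then have "\<forall>k\<in>{i, j}. (if k = i then 1 else -1 :: 'a) = 0"
      using ij by (intro assms) auto
    then show False by simp
  qed
  show "independent (w ` I)"
    unfolding independent_explicit_module
  proof (intro allI impI)
    fix T u v assume T: "finite T" "T \<subseteq> w ` I" "(\<Sum>v\<in>T. scale (u v) v) = 0" "v \<in> T"
    then obtain J where J: "J \<subseteq> I" "inj_on w J" "T = w ` J"
      by (auto simp: subset_image_inj)
    have "finite J" using T J finite_image_iff by blast
    moreover have "(\<Sum>j\<in>J. scale (u (w j)) (w j)) = 0"
      using T J by (simp add: sum.reindex)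
    ultimately have "\<forall>j\<in>J. u (w j) = 0"
      using J assms[of J "\<lambda>j. u (w j)"] by blast
    then show "u v = 0" using T J by auto
  qed
qed

lemma (in vector_space) span_image_sumE:
  assumes "x \<in> span (w ` I)"
  obtains J a where "finite J" "J \<subseteq> I" "x = (\<Sum>j\<in>J. scale (a j) (w j))"
proof -
  obtain T r where T: "finite T" "T \<subseteq> w ` I" "x = (\<Sum>v\<in>T. scale (r v) v)"
    using assms unfolding span_explicit by auto
  then obtain J where J: "J \<subseteq> I" "inj_on w J" "T = w ` J"
    by (auto simp: subset_image_inj)
  show thesis
  proof (rule that)
    show "finite J" using T J finite_image_iff by blast
    show "x = (\<Sum>j\<in>J. scale (r (w j)) (w j))" using T J by (simp add: sum.reindex)
  qed (rule J)
qed

section \<open>Bounded sequences\<close>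

interpretation linf: vector_space "linf_scale :: 'k::real_normed_field \<Rightarrow> 'k linf \<Rightarrow> 'k linf"
  by (rule vector_space_linf_scale)

lemma apply_Bcontfun_seq:
  fixes f :: "nat \<Rightarrow> 'k::real_normed_field"
  assumes "\<And>n. norm (f n) \<le> b"
  shows "apply_bcontfun (Bcontfun f) = f"
  using assms by (intro Bcontfun_inverse bcontfun_normI) auto

lemma apply_linf_scale_fun: "apply_bcontfun (linf_scale a x) = (\<lambda>n. a * apply_bcontfun x n)"
  by (rule ext) simp

lemma apply_bcontfun_sum: "apply_bcontfun (sum f J) n = (\<Sum>j\<in>J. apply_bcontfun (f j) n)"
  by (induction J rule: infinite_finite_induct) auto

lemma norm_linf_scale:
  fixes x :: "'k::real_normed_field linf"
  shows "norm (linf_scale a x) = norm a * norm x"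
proof (cases "a = 0")
  case False
  have le: "norm (linf_scale a x) \<le> norm a * norm x" for a :: 'k and x :: "'k linf"
    by (rule norm_bound) (auto simp: norm_mult intro: mult_left_mono norm_bounded)
  have "norm x = norm (linf_scale (inverse a) (linf_scale a x))"
    using False by simp
  also have "\<dots> \<le> inverse (norm a) * norm (linf_scale a x)"
    using le[of "inverse a" "linf_scale a x"] by (simp add: norm_inverse)
  finally have "norm a * norm x \<le> norm (linf_scale a x)"
    using False by (simp add: field_simps)
  with le[of a x] show ?thesis by simp
qed simp

lemma tendsto_apply_bcontfun:
  "(f \<longlongrightarrow> l) F \<Longrightarrow> ((\<lambda>x. apply_bcontfun (f x) n) \<longlongrightarrow> apply_bcontfun l n) F"
  by (rule metric_tendsto_imp_tendsto) (auto intro: always_eventually dist_bounded)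

lemma tendsto_linf_scale:
  fixes x :: "'k::real_normed_field linf"
  assumes "(a \<longlongrightarrow> a0) F"
  shows "((\<lambda>i. linf_scale (a i) x) \<longlongrightarrow> linf_scale a0 x) F"
proof -
  have "((\<lambda>i. norm (a i - a0) * norm x) \<longlongrightarrow> 0) F"
    using assms by (auto intro!: tendsto_mult_left_zero tendsto_norm_zero simp: LIM_zero_iff)
  then have "((\<lambda>i. norm (linf_scale (a i) x - linf_scale a0 x)) \<longlongrightarrow> 0) F"
    by (simp add: norm_linf_scale flip: linf.scale_left_diff_distrib)
  then show ?thesis
    using LIM_zero_iff tendsto_norm_zero_iff by blast
qed

text \<open>
  A vector \<open>w\<close> at distance \<open>d > 0\<close> from the closed span satisfies \<open>\<bar>a\<bar> d \<le> norm (v + a w)\<close> for all \<open>v\<close> in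
  the span. So along a convergent sequence the coefficients of \<open>w\<close> form a Cauchy sequence; they
  converge by completeness of the scalars, and then so do the components in the closed span.
\<close>

lemma closed_span_insert:
  fixes S :: "'k::{real_normed_field, banach} linf set"
  assumes cl: "closed (linf.span S)"
  shows "closed (linf.span (insert w S))"
proof (cases "w \<in> linf.span S")
  case True
  then show ?thesis using cl by (simp add: linf.span_redundant)
next
  case False
  define d where "d = infdist w (linf.span S)"
  have d: "d > 0"
    using False cl linf.span_zero[of S] unfolding d_def
    by (metis empty_iff in_closed_iff_infdist_zero infdist_nonneg order_less_le)
  have bound: "norm a * d \<le> norm (v + linf_scale a w)" if v: "v \<in> linf.span S" for a v
  proof (cases "a = 0")
    case False
    have "linf_scale (- inverse a) v \<in> linf.span S" using v by (rule linf.span_scale)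
    then have "d \<le> dist w (linf_scale (- inverse a) v)"
      unfolding d_def by (rule infdist_le)
    also have "\<dots> = norm (linf_scale (inverse a) (v + linf_scale a w))"
      using False by (simp add: dist_norm linf.scale_right_distrib add.commute)
    also have "\<dots> = norm (v + linf_scale a w) / norm a"
      by (simp add: norm_linf_scale norm_inverse divide_inverse mult.commute)
    finally show ?thesis using False by (simp add: field_simps)
  qed simp
  show ?thesis
    unfolding closed_sequential_limits
  proof (intro allI impI, elim conjE)
    fix z l assume "\<forall>n. z n \<in> linf.span (insert w S)" and lim: "z \<longlonglongrightarrow> l"
    then have "\<forall>n. \<exists>a. z n - linf_scale a w \<in> linf.span S"
      by (simp add: linf.span_breakdown_eq)
    then obtain a where a: "z n - linf_scale (a n) w \<in> linf.span S" for n
      by metis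
    have le: "dist (a m) (a n) \<le> dist (z m) (z n) / d" for m n
    proof -
      have "(z m - linf_scale (a m) w) - (z n - linf_scale (a n) w) \<in> linf.span S"
        by (intro linf.span_diff a)
      from bound[OF this, of "a m - a n"]
      have "norm (a m - a n) * d \<le> norm (z m - z n)"
        by (simp add: linf.scale_left_diff_distrib algebra_simps)
      then show ?thesis using d by (simp add: dist_norm field_simps)
    qed
    have "Cauchy a"
    proof (rule metric_CauchyI)
      fix e :: real assume "e > 0"
      then have "e * d > 0" using d by simp
      then obtain M where M: "\<And>m n. m \<ge> M \<Longrightarrow> n \<ge> M \<Longrightarrow> dist (z m) (z n) < e * d"
        using LIMSEQ_imp_Cauchy[OF lim] metric_CauchyD by blast
      show "\<exists>M. \<forall>m\<ge>M. \<forall>n\<ge>M. dist (a m) (a n) < e"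
      proof (intro exI allI impI)
        fix m n assume "m \<ge> M" "n \<ge> M"
        then have "dist (z m) (z n) / d < e" using M d by (simp add: field_simps)
        then show "dist (a m) (a n) < e" using le[of m n] by linarith
      qed
    qed
    then obtain a0 where "a \<longlonglongrightarrow> a0"
      using Cauchy_convergent_iff convergent_def by blast
    then have "(\<lambda>n. z n - linf_scale (a n) w) \<longlonglongrightarrow> l - linf_scale a0 w"
      by (intro tendsto_diff lim tendsto_linf_scale)
    then have "l - linf_scale a0 w \<in> linf.span S"
      by (rule closed_sequentially[OF cl a])
    then show "l \<in> linf.span (insert w S)"
      by (auto simp: linf.span_breakdown_eq)
  qed
qed

lemma closed_span_Un_finite:
  fixes V :: "'k::{real_normed_field, banach} linf set"
  assumes "linf.subspace V" "closed V" "finite B"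
  shows "closed (linf.span (B \<union> V))"
  using \<open>finite B\<close>
proof induction
  case empty
  have "linf.span V = V" using assms by simp
  then show ?case using assms by (metis Un_empty_left)
qed (auto intro: closed_span_insert)

text \<open>
  An injection of the scalars into the reals turns sequences into real ones. A real sequence is
  determined by the set of pairs of an index and a rational below the term at that index, so there
  are no more sequences than sets of natural numbers.
\<close>

lemma card_linf_le:
  assumes "|UNIV :: 'k::real_normed_field set| \<le>o |UNIV :: real set|"
  shows "|UNIV :: 'k linf set| \<le>o |UNIV :: real set|"
proof -
  obtain g :: "'k \<Rightarrow> real" where g: "inj g"
    using assms unfolding card_of_ordLeq[symmetric] by auto
  define F where "F x = to_nat ` {(n, q). of_rat q < g (apply_bcontfun x n)}" for x :: "'k linf"
  have "inj F"
  proof (rule injI, rule bcontfun_eqI, rule ccontr)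
    fix x y n assume eq: "F x = F y" and ne: "apply_bcontfun x n \<noteq> apply_bcontfun y n"
    have cut: "of_rat q < g (apply_bcontfun x n) \<longleftrightarrow> of_rat q < g (apply_bcontfun y n)" for q
    proof -
      have "{(n, q). of_rat q < g (apply_bcontfun x n)} = {(n, q). of_rat q < g (apply_bcontfun y n)}"
        using eq unfolding F_def by (simp add: inj_image_eq_iff)
      then show ?thesis by (auto dest: eqset_imp_iff[of _ _ "(n, q)"])
    qed
    have "g (apply_bcontfun x n) \<noteq> g (apply_bcontfun y n)"
      using ne g by (simp add: inj_eq)
    then show False
      using cut of_rat_dense by (metis less_asym linorder_neqE_linordered_idom)
  qed
  moreover obtain h :: "nat set \<Rightarrow> real" where "inj h"
    using nat_sets_eqpoll_reals unfolding eqpoll_def bij_betw_def by auto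
  ultimately have "inj (h \<circ> F)" by (rule inj_compose[rotated])
  then show ?thesis by (rule card_of_ordLeqI) simp
qed

section \<open>Block-constant sequences\<close>

definition pos :: "nat \<Rightarrow> nat \<Rightarrow> nat \<Rightarrow> nat" where
  "pos j b i = prod_encode (j, prod_encode (b, i))"

lemma pos_cases: obtains j b i where "n = pos j b i"
  by (metis pos_def prod_decode_inverse surj_pair)

lemma filterlim_pos: "filterlim (pos j b) at_top sequentially"
proof (rule filterlim_at_top_mono[OF filterlim_ident])
  show "\<forall>\<^sub>F i in sequentially. i \<le> pos j b i"
    unfolding pos_def by (intro always_eventually allI order.trans[OF le_prod_encode_2 le_prod_encode_2])
qed

text \<open>
  The definition uses only equations between coordinates, so closedness and linearity are immediate.
\<close>

definition row_space :: "nat \<Rightarrow> 'k::real_normed_field linf set" where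
  "row_space j = {x. (\<forall>k b i. k \<noteq> j \<longrightarrow> apply_bcontfun x (pos k b i) = 0) \<and>
     (\<forall>b i i'. apply_bcontfun x (pos j b i) = apply_bcontfun x (pos j b i'))}"

lemma row_spaceD:
  assumes "x \<in> row_space j"
  shows "k \<noteq> j \<Longrightarrow> apply_bcontfun x (pos k b i) = 0"
    and "apply_bcontfun x (pos j b i) = apply_bcontfun x (pos j b i')"
  using assms unfolding row_space_def by blast+

lemma row_spaceI:
  assumes "\<And>k b i. k \<noteq> j \<Longrightarrow> apply_bcontfun x (pos k b i) = 0"
    and "\<And>b i i'. apply_bcontfun x (pos j b i) = apply_bcontfun x (pos j b i')"
  shows "x \<in> row_space j"
  using assms unfolding row_space_def by blast

lemma subspace_row_space: "linf.subspace (row_space j :: 'k::real_normed_field linf set)"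
proof (rule linf.subspaceI)
  fix x y :: "'k linf" and a :: 'k
  assume x: "x \<in> row_space j"
  show "linf_scale a x \<in> row_space j"
  proof (rule row_spaceI)
    show "apply_bcontfun (linf_scale a x) (pos j b i) = apply_bcontfun (linf_scale a x) (pos j b i')"
      for b i i' using row_spaceD(2)[OF x, of b i i'] by simp
  qed (simp add: row_spaceD(1)[OF x])
  assume y: "y \<in> row_space j"
  show "x + y \<in> row_space j"
  proof (rule row_spaceI)
    show "apply_bcontfun (x + y) (pos j b i) = apply_bcontfun (x + y) (pos j b i')" for b i i'
      using row_spaceD(2)[OF x, of b i i'] row_spaceD(2)[OF y, of b i i'] by simp
  qed (simp add: row_spaceD(1)[OF x] row_spaceD(1)[OF y])
qed (simp add: row_space_def)

lemma closed_row_space: "closed (row_space j :: 'k::real_normed_field linf set)"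
proof -
  have cont: "continuous_on UNIV (\<lambda>x :: 'k linf. apply_bcontfun x n)" for n
    unfolding continuous_on_def by (auto intro: tendsto_apply_bcontfun)
  show ?thesis
    unfolding row_space_def
    by (intro closed_Collect_conj closed_Collect_all closed_Collect_imp closed_Collect_eq
        open_Collect_const cont continuous_on_const)
qed

text \<open>
  A row outside the finite set \<open>J\<close> shows that the limit must be 0. Along a block \<open>i \<mapsto> pos j b i\<close> the
  sum is constant with the value of its summand \<open>e j\<close>, so that value equals the limit.
\<close>

lemma convergent_row_sum_imp_zero:
  assumes J: "finite J" and e: "\<And>j. j \<in> J \<Longrightarrow> e j \<in> row_space j"
    and s: "sum e J \<in> c_seqs" and j: "j \<in> J"
  shows "e j = 0"
proof (rule bcontfun_eqI)
  fix n
  obtain l where l: "apply_bcontfun (sum e J) \<longlonglongrightarrow> l"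
    using s by (auto simp: c_seqs_def convergent_def)
  have lim: "(\<lambda>i. apply_bcontfun (sum e J) (pos k b i)) \<longlonglongrightarrow> l" for k b
    by (rule filterlim_compose[OF l filterlim_pos])
  have val: "apply_bcontfun (sum e J) (pos k b i) =
      (if k \<in> J then apply_bcontfun (e k) (pos k b i) else 0)" for k b i
  proof -
    have "apply_bcontfun (sum e J) (pos k b i) =
        (\<Sum>j\<in>J. if j = k then apply_bcontfun (e k) (pos k b i) else 0)"
      unfolding apply_bcontfun_sum using e by (intro sum.cong) (auto simp: row_space_def)
    then show ?thesis using J by simp
  qed
  obtain k where "k \<notin> J" using J ex_new_if_finite infinite_UNIV_nat by blast
  with lim[of k 0] have "l = 0" by (simp add: val LIMSEQ_const_iff)
  obtain k b i where n: "n = pos k b i" by (rule pos_cases)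
  show "apply_bcontfun (e j) n = apply_bcontfun 0 n"
  proof (cases "k = j")
    case True
    have "(\<lambda>i'. apply_bcontfun (sum e J) (pos j b i')) = (\<lambda>_. apply_bcontfun (e j) (pos j b i))"
      by (rule ext) (simp only: val j if_True, rule row_spaceD(2)[OF e[OF j]])
    with lim[of j b] \<open>l = 0\<close> have "apply_bcontfun (e j) (pos j b i) = 0"
      by (simp add: LIMSEQ_const_iff)
    then show ?thesis using n True by simp
  next
    case False
    then show ?thesis using e[OF j] n by (auto simp: row_space_def)
  qed
qed

lemma row_space_Int_c_seqs: "x \<in> row_space j \<Longrightarrow> x \<in> c_seqs \<Longrightarrow> x = 0"
  using convergent_row_sum_imp_zero[of "{j}" "\<lambda>_. x" j] by simp

text \<open>
  On row \<open>j\<close> this is the indicator of the rationals below \<open>t\<close>, with the rationals enumerated by the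
  block index. Linear independence of these Dedekind cuts exhibits dimension continuum.
\<close>

definition step :: "nat \<Rightarrow> real \<Rightarrow> 'k::real_normed_field linf" where
  "step j t = Bcontfun (\<lambda>n. case prod_decode n of (k, m) \<Rightarrow>
     if k = j \<and> of_rat (from_nat (fst (prod_decode m))) < t then 1 else 0)"

lemma apply_step:
  "apply_bcontfun (step j t) (pos k b i) = (if k = j \<and> of_rat (from_nat b) < t then 1 else 0)"
  unfolding step_def
  by (subst apply_Bcontfun_seq[where b = 1]) (auto simp: pos_def split: prod.split)

lemma step_in_row_space: "step j t \<in> row_space j"
  by (auto simp: row_space_def apply_step)

lemma norm_step_le: "norm (step j t :: 'k::real_normed_field linf) \<le> 1"
proof (rule norm_bound)
  fix n
  show "norm (apply_bcontfun (step j t :: 'k linf) n) \<le> 1"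
    by (rule pos_cases[of n]) (simp add: apply_step)
qed

text \<open>
  Let \<open>t0\<close> be the largest index with nonzero coefficient. A rational just below \<open>t0\<close> lies above
  all other such indices, so the corresponding coordinate of the sum is \<open>a t0\<close>.
\<close>

lemma step_sum_zero_imp:
  assumes J: "finite J" and s: "(\<Sum>t\<in>J. linf_scale (a t) (step j t)) = 0"
  shows "\<forall>t\<in>J. a t = 0"
proof (rule ccontr)
  assume "\<not> (\<forall>t\<in>J. a t = 0)"
  define T where "T = {t \<in> J. a t \<noteq> 0}"
  have T: "finite T" "T \<noteq> {}" using J \<open>\<not> _\<close> by (auto simp: T_def)
  define t0 where "t0 = Max T"
  have t0: "t0 \<in> T" "\<And>t. t \<in> T \<Longrightarrow> t \<le> t0" using T by (auto simp: t0_def)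
  \<comment> \<open>The extra element \<open>t0 - 1\<close> keeps the set nonempty when \<open>T = {t0}\<close>.\<close>
  define m where "m = Max (insert (t0 - 1) (T - {t0}))"
  have "m \<in> insert (t0 - 1) (T - {t0})" unfolding m_def using T by (intro Max_in) auto
  then have "m < t0" using t0 by (auto simp: order_less_le)
  then obtain q where q: "m < of_rat q" "of_rat q < t0" using of_rat_dense by blast
  have m: "t \<le> m" if "t \<in> T" "t \<noteq> t0" for t unfolding m_def using T that by auto
  have "0 = apply_bcontfun (\<Sum>t\<in>J. linf_scale (a t) (step j t)) (pos j (to_nat q) 0)"
    by (simp add: s)
  also have "\<dots> = (\<Sum>t\<in>J. if t = t0 then a t0 else 0)"
    unfolding apply_bcontfun_sum
  proof (rule sum.cong)
    fix t assume "t \<in> J"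
    show "apply_bcontfun (linf_scale (a t) (step j t)) (pos j (to_nat q) 0) =
        (if t = t0 then a t0 else 0)"
      using q m[of t] \<open>t \<in> J\<close> by (cases "t = t0"; cases "a t = 0") (auto simp: apply_step T_def)
  qed simp
  also have "\<dots> = a t0" using J t0 by (simp add: T_def)
  finally show False using t0 by (simp add: T_def)
qed

lemma inj_step: "inj_on (step j :: real \<Rightarrow> 'k::real_normed_field linf) I"
  and independent_step: "linf.independent ((step j :: real \<Rightarrow> 'k linf) ` I)"
  using step_sum_zero_imp by (intro linf.independent_family; blast)+

section \<open>Spaceability of the complement of a subspace of \<open>c\<close>\<close>

lemma subspace_of_dimI:
  assumes "Card_order \<alpha>" "|I| =o \<alpha>" "inj_on w I" "linf.independent (w ` I)"
  shows "subspace_of_dim linf_scale \<alpha> (linf.span (w ` I))"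
proof -
  have "|w ` I| =o |I|"
    using assms(3) by (meson card_of_ordIsoI inj_on_imp_bij_betw ordIso_symmetric)
  then show ?thesis
    unfolding subspace_of_dim_def using assms ordIso_transitive by blast
qed

text \<open>
  The step sequences extend to a basis, and a basis cannot exceed the size of the whole space.
\<close>

lemma dim_continuum_if_row_space_subset:
  fixes W :: "'k::real_normed_field linf set"
  assumes "|UNIV :: 'k set| \<le>o |UNIV :: real set|" "linf.subspace W" "row_space j \<subseteq> W"
  shows "subspace_of_dim linf_scale |UNIV :: real set| W"
proof -
  have "range (step j) \<subseteq> W" using assms step_in_row_space by blast
  then obtain B where B: "range (step j) \<subseteq> B" "B \<subseteq> W" "linf.independent B" "W \<subseteq> linf.span B"
    using linf.maximal_independent_subset_extend independent_step by metis
  have "linf.span B = W"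
    using B assms by (simp add: linf.span_minimal subset_antisym)
  moreover have "|B| \<le>o |UNIV :: real set|"
    using card_of_mono1[OF subset_UNIV] card_linf_le[OF assms(1)] ordLeq_transitive by blast
  moreover have "|UNIV :: real set| \<le>o |B|"
    using inj_step[of j UNIV] B by (intro card_of_ordLeqI[of "step j"]) auto
  ultimately show ?thesis
    unfolding subspace_of_dim_def using B assms ordIso_iff_ordLeq by blast
qed

text \<open>
  Infinitely many row spaces are in direct sum modulo \<open>C\<close>, and a finite-dimensional space can
  interfere with only finitely many of them; any of the others may be added to it.
\<close>

lemma finite_dim_extension:
  fixes C :: "'k::{real_normed_field, banach} linf set"
  assumes card: "|UNIV :: 'k set| \<le>o |UNIV :: real set|"
    and C: "linf.subspace C" "C \<subseteq> c_seqs"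
    and B: "finite B" and disj: "linf.span B \<inter> C \<subseteq> {0}"
  obtains W' where "subspace_of_dim linf_scale |UNIV :: real set| W'" "closed W'"
    "linf.span B \<subseteq> W'" "W' \<inter> C \<subseteq> {0}"
proof -
  have "\<exists>j. \<forall>w\<in>linf.span B. \<forall>y\<in>C. w + y \<in> row_space j \<longrightarrow> w + y = 0"
  proof (rule ccontr)
    assume "\<not> ?thesis"
    then obtain w y where wy: "w j \<in> linf.span B" "y j \<in> C" "w j + y j \<in> row_space j"
      "w j + y j \<noteq> 0" for j
      by metis
    have zero: "\<forall>j\<in>J. a j = 0"
      if J: "finite J" and s: "(\<Sum>j\<in>J. linf_scale (a j) (w j)) = 0" for J a
    proof
      fix j assume "j \<in> J"
      have "(\<Sum>j\<in>J. linf_scale (a j) (w j + y j)) = (\<Sum>j\<in>J. linf_scale (a j) (y j))"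
        using s by (simp add: linf.scale_right_distrib sum.distrib)
      also have "\<dots> \<in> C" by (intro linf.subspace_sum linf.subspace_scale C wy)
      finally have "(\<Sum>j\<in>J. linf_scale (a j) (w j + y j)) \<in> c_seqs" using C by blast
      then have "linf_scale (a j) (w j + y j) = 0"
        using convergent_row_sum_imp_zero[OF J _ _ \<open>j \<in> J\<close>, of "\<lambda>j. linf_scale (a j) (w j + y j)"]
          linf.subspace_scale[OF subspace_row_space wy(3)] by blast
      then show "a j = 0" using wy(4) by simp
    qed
    have "inj w" "linf.independent (range w)"
      using zero by (intro linf.independent_family; blast)+
    moreover have "range w \<subseteq> linf.span B" using wy by auto
    ultimately have "finite (range w)" using linf.independent_span_bound[OF B] by blast
    then show False using \<open>inj w\<close> finite_imageD infinite_UNIV_nat by blast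
  qed
  then obtain j where j: "w + y = 0"
    if "w \<in> linf.span B" "y \<in> C" "w + y \<in> row_space j" for w y
    by blast
  define W' where "W' = linf.span (B \<union> row_space j)"
  show thesis
  proof (rule that)
    show "subspace_of_dim linf_scale |UNIV :: real set| W'"
      unfolding W'_def
      by (intro dim_continuum_if_row_space_subset[OF card]) (auto intro: linf.span_base)
    show "closed W'"
      unfolding W'_def by (intro closed_span_Un_finite subspace_row_space closed_row_space B)
    show "linf.span B \<subseteq> W'" unfolding W'_def by (intro linf.span_mono) auto
    show "W' \<inter> C \<subseteq> {0}"
    proof
      fix x assume x: "x \<in> W' \<inter> C"
      moreover have "linf.span (row_space j :: 'k linf set) = row_space j"
        using subspace_row_space by simp
      ultimately obtain w v where wv: "x = w + v" "w \<in> linf.span B" "v \<in> row_space j"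
        unfolding W'_def linf.span_Un by auto
      have "- w + x = 0"
        using wv x by (intro j linf.span_neg) auto
      then have "x \<in> linf.span B" using wv by simp
      then show "x \<in> {0}" using disj x by blast
    qed
  qed
qed

text \<open>
  Perturbing \<open>u\<close> by smaller and smaller multiples of step sequences gives vectors that are independent
  modulo \<open>C\<close> although they accumulate at \<open>u \<in> C\<close>.
\<close>

lemma infinite_dim_obstruction:
  fixes C :: "'k::real_normed_field linf set"
  assumes C: "linf.subspace C" "C \<subseteq> c_seqs" and u: "u \<in> C" and I: "infinite I"
  obtains w :: "real \<Rightarrow> 'k linf" where "inj_on w I" "linf.independent (w ` I)"
    "linf.span (w ` I) \<inter> C \<subseteq> {0}" "u \<in> closure (w ` I)"
proof -
  obtain g :: "nat \<Rightarrow> real" where g: "inj g" "range g \<subseteq> I"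
    using I infinite_countable_subset by blast
  \<comment> \<open>The sequence \<open>h (g k)\<close> tends to 0; outside \<open>range g\<close> only \<open>h t \<noteq> 0\<close> matters.\<close>
  define h where "h t = inverse (of_nat (Suc (inv g t)) :: 'k)" for t
  have h: "h t \<noteq> 0" for t unfolding h_def by (simp del: of_nat_Suc)
  define w where "w t = u + linf_scale (h t) (step 0 t)" for t
  have zero: "\<forall>t\<in>J. a t = 0"
    if J: "finite J" and s: "(\<Sum>t\<in>J. linf_scale (a t) (w t)) \<in> C" for J a
  proof -
    let ?s = "\<Sum>t\<in>J. linf_scale (a t * h t) (step 0 t)"
    have "?s = (\<Sum>t\<in>J. linf_scale (a t) (w t)) - (\<Sum>t\<in>J. linf_scale (a t) u)"
      unfolding w_def by (simp add: linf.scale_right_distrib sum.distrib)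
    also have "\<dots> \<in> C"
      by (intro linf.subspace_diff linf.subspace_sum linf.subspace_scale C s u)
    finally have "?s \<in> c_seqs" using C by blast
    moreover have "?s \<in> row_space 0"
      by (intro linf.subspace_sum linf.subspace_scale subspace_row_space step_in_row_space)
    ultimately have "?s = 0" by (intro row_space_Int_c_seqs)
    from step_sum_zero_imp[OF J this] show ?thesis using h by simp
  qed
  have li: "\<forall>t\<in>J. a t = 0"
    if "finite J" "(\<Sum>t\<in>J. linf_scale (a t) (w t)) = 0" for J a
    using that C by (intro zero) (simp_all add: linf.subspace_0)
  show thesis
  proof (rule that)
    show "inj_on w I" "linf.independent (w ` I)"
      using li by (intro linf.independent_family; blast)+
    show "linf.span (w ` I) \<inter> C \<subseteq> {0}"
    proof
      fix x assume x: "x \<in> linf.span (w ` I) \<inter> C"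
      then obtain J a where J: "finite J" "x = (\<Sum>t\<in>J. linf_scale (a t) (w t))"
        by (auto elim: linf.span_image_sumE)
      then have "\<forall>t\<in>J. a t = 0" using zero x by blast
      then show "x \<in> {0}" using J by simp
    qed
    have "(\<lambda>k. w (g k) - u) \<longlonglongrightarrow> 0"
    proof (rule Lim_null_comparison)
      show "\<forall>\<^sub>F k in sequentially. norm (w (g k) - u) \<le> inverse (real (Suc k))"
      proof (intro always_eventually allI)
        fix k
        have "norm (w (g k) - u) = inverse (real (Suc k)) * norm (step 0 (g k) :: 'k linf)"
          unfolding w_def h_def using g
          by (simp add: norm_linf_scale norm_inverse del: of_nat_Suc)
        also have "\<dots> \<le> inverse (real (Suc k)) * 1"
          by (intro mult_left_mono norm_step_le) auto
        finally show "norm (w (g k) - u) \<le> inverse (real (Suc k))" by simp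
      qed
    qed (rule LIMSEQ_inverse_real_of_nat)
    then have "(\<lambda>k. w (g k)) \<longlonglongrightarrow> u" by (rule LIM_zero_cancel)
    moreover have "w (g k) \<in> w ` I" for k using g by auto
    ultimately show "u \<in> closure (w ` I)"
      unfolding closure_sequential by (intro exI[of _ "\<lambda>k. w (g k)"]) simp
  qed
qed

text \<open>
  The hypothesis \<open>C \<noteq> {0}\<close> is what makes infinite \<open>\<alpha>\<close> fail: the obstruction is a nonzero vector of \<open>C\<close>
  in the closure. The cardinality hypothesis on the scalars bounds the dimension of \<open>\<ell>\<^sub>\<infinity>\<close> by the continuum.
\<close>

theorem spaceable_Compl_iff:
  fixes C :: "'k::{real_normed_field, banach} linf set" and \<alpha> :: "'c rel"
  assumes card: "|UNIV :: 'k set| \<le>o |UNIV :: real set|"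
    and C: "linf.subspace C" "C \<subseteq> c_seqs" and nz: "C \<noteq> {0}"
    and \<alpha>: "Card_order \<alpha>" "\<alpha> \<le>o |UNIV :: real set|"
  shows "spaceable linf_scale \<alpha> |UNIV :: real set| (UNIV - C) \<longleftrightarrow> \<alpha> <o natLeq"
proof -
  \<comment> \<open>Replacing \<open>\<alpha>\<close> by a set of reals makes it an index set for step sequences.\<close>
  have "|Field \<alpha>| \<le>o |UNIV :: real set|"
    using \<alpha> card_of_Field_ordIso ordIso_ordLeq_trans by blast
  then obtain f :: "'c \<Rightarrow> real" where f: "inj_on f (Field \<alpha>)"
    unfolding card_of_ordLeq[symmetric] by auto
  define I where "I = f ` Field \<alpha>"
  have I: "|I| =o \<alpha>"
    using card_of_Field_ordIso[OF \<alpha>(1)] card_of_ordIsoI[OF inj_on_imp_bij_betw[OF f]]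
    unfolding I_def by (meson ordIso_symmetric ordIso_transitive)
  have fin: "finite X \<longleftrightarrow> \<alpha> <o natLeq" if "|X| =o \<alpha>" for X :: "'z set"
    unfolding finite_iff_ordLess_natLeq
    using ordIso_ordLess_trans[OF that] ordIso_ordLess_trans[OF ordIso_symmetric[OF that]] by iprover
  have C0: "0 \<in> C" using C by (simp add: linf.subspace_0)
  show ?thesis
  proof
    assume sp: "spaceable linf_scale \<alpha> |UNIV :: real set| (UNIV - C)"
    show "\<alpha> <o natLeq"
    proof (rule ccontr)
      assume "\<not> \<alpha> <o natLeq"
      then have "infinite I" using fin[OF I] by simp
      obtain u where u: "u \<in> C" "u \<noteq> 0" using nz C0 by blast
      obtain w :: "real \<Rightarrow> 'k linf" where w: "inj_on w I" "linf.independent (w ` I)"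
        "linf.span (w ` I) \<inter> C \<subseteq> {0}" "u \<in> closure (w ` I)"
        using infinite_dim_obstruction[OF C u(1) \<open>infinite I\<close>] by blast
      have "subspace_of_dim linf_scale \<alpha> (linf.span (w ` I))"
        by (intro subspace_of_dimI \<alpha> I w)
      moreover have "linf.span (w ` I) \<subseteq> (UNIV - C) \<union> {0}" using w(3) by blast
      ultimately obtain W' where W': "closed W'" "linf.span (w ` I) \<subseteq> W'" "W' \<subseteq> (UNIV - C) \<union> {0}"
        using sp unfolding spaceable_def by (metis (no_types, lifting))
      have "w ` I \<subseteq> W'" using W'(2) linf.span_superset by blast
      then have "u \<in> W'" using w(4) closure_minimal[OF _ W'(1)] by blast
      then show False using W'(3) u by blast
    qed
  next
    assume "\<alpha> <o natLeq"
    have span: "linf.span (step 0 ` I) \<subseteq> row_space 0" for I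
      by (intro linf.span_minimal subspace_row_space) (auto intro: step_in_row_space)
    have ne: "step 0 0 \<in> UNIV - C"
    proof
      show "step 0 0 \<notin> C"
      proof
        assume "step 0 0 \<in> C"
        then have "step 0 0 = (0 :: 'k linf)"
          using C row_space_Int_c_seqs[OF step_in_row_space] by blast
        then show False
          using independent_step[where 'k = 'k, of 0 "{0}"] by simp
      qed
    qed simp
    have "subspace_of_dim linf_scale \<alpha> (linf.span ((step 0 :: real \<Rightarrow> 'k linf) ` I))"
      by (intro subspace_of_dimI \<alpha> I inj_step independent_step)
    moreover have "linf.span (step 0 ` I) \<subseteq> (UNIV - C) \<union> {0}"
      using span row_space_Int_c_seqs C by blast
    ultimately have lin: "lineable linf_scale \<alpha> (UNIV - C)"
      unfolding lineable_def by blast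
    have "\<exists>W'. subspace_of_dim linf_scale |UNIV :: real set| W' \<and> closed W' \<and> W \<subseteq> W' \<and>
        W' \<subseteq> (UNIV - C) \<union> {0}"
      if W: "subspace_of_dim linf_scale \<alpha> W" "W \<subseteq> (UNIV - C) \<union> {0}" for W
    proof -
      obtain B where B: "linf.span B = W" "|B| =o \<alpha>"
        using W(1) unfolding subspace_of_dim_def by blast
      have "finite B" using fin[OF B(2)] \<open>\<alpha> <o natLeq\<close> by blast
      moreover have "linf.span B \<inter> C \<subseteq> {0}" using B W(2) by blast
      ultimately obtain W' where "subspace_of_dim linf_scale |UNIV :: real set| W'" "closed W'"
        "linf.span B \<subseteq> W'" "W' \<inter> C \<subseteq> {0}"
        by (rule finite_dim_extension[OF card C])
      then show ?thesis using B(1) by (intro exI[of _ W'] conjI) auto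
    qed
    then show "spaceable linf_scale \<alpha> |UNIV :: real set| (UNIV - C)"
      unfolding spaceable_def using lin ne \<alpha>(2) by (metis empty_iff)
  qed
qed

section \<open>The subspaces \<open>c\<close> and \<open>c\<^sub>0\<close>\<close>

lemma subspace_c_seqs: "linf.subspace c_seqs"
  unfolding linf.subspace_def c_seqs_def
  by (auto simp: convergent_const apply_linf_scale_fun intro!: convergent_add convergent_mult)

lemma subspace_c0_seqs: "linf.subspace c0_seqs"
  unfolding linf.subspace_def c0_seqs_def
  by (auto simp: apply_linf_scale_fun intro!: tendsto_add_zero tendsto_mult_right_zero)

lemma c0_seqs_subset_c_seqs: "c0_seqs \<subseteq> c_seqs"
  by (auto simp: c0_seqs_def c_seqs_def convergent_def)

lemma c0_seqs_nonzero: "c0_seqs \<noteq> ({0} :: 'k::real_normed_field linf set)"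
proof -
  define x :: "'k linf" where "x = Bcontfun (\<lambda>n. if n = 0 then 1 else 0)"
  have x: "apply_bcontfun x = (\<lambda>n. if n = 0 then 1 else 0)"
    unfolding x_def by (rule apply_Bcontfun_seq[of _ 1]) simp
  have "x \<in> c0_seqs"
    by (auto simp: c0_seqs_def x intro!: tendsto_eventually eventually_sequentiallyI[of 1])
  moreover have "x \<noteq> 0" using fun_cong[OF x, of 0] by auto
  ultimately show ?thesis by blast
qed

lemma card_complex_le: "|UNIV :: complex set| \<le>o |UNIV :: real set|"
proof -
  have "|UNIV :: complex set| \<le>o |(UNIV :: real set) \<times> (UNIV :: real set)|"
    by (rule card_of_ordLeqI[of "\<lambda>z. (Re z, Im z)"]) (auto intro: injI complex_eqI)
  also have "|(UNIV :: real set) \<times> (UNIV :: real set)| =o |UNIV :: real set|"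
    by (intro card_of_Times_same_infinite infinite_UNIV_char_0)
  finally show ?thesis .
qed

theorem corollary3p8:
  fixes \<alpha> :: "'c rel"
  assumes "Card_order \<alpha>" and "\<alpha> \<le>o |UNIV :: real set|"
  shows "(spaceable linf_scale \<alpha> |UNIV :: real set| (UNIV - c_seqs :: real linf set) \<longleftrightarrow> \<alpha> <o natLeq)
       \<and> (spaceable linf_scale \<alpha> |UNIV :: real set| (UNIV - c0_seqs :: real linf set) \<longleftrightarrow> \<alpha> <o natLeq)
       \<and> (spaceable linf_scale \<alpha> |UNIV :: real set| (UNIV - c_seqs :: complex linf set) \<longleftrightarrow> \<alpha> <o natLeq)
       \<and> (spaceable linf_scale \<alpha> |UNIV :: real set| (UNIV - c0_seqs :: complex linf set) \<longleftrightarrow> \<alpha> <o natLeq)"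
proof -
  have c_nz: "c_seqs \<noteq> ({0} :: 'k::real_normed_field linf set)"
    using c0_seqs_nonzero c0_seqs_subset_c_seqs linf.subspace_0[OF subspace_c0_seqs] by blast
  note c = spaceable_Compl_iff[OF _ subspace_c_seqs subset_refl c_nz assms]
    and c0 = spaceable_Compl_iff[OF _ subspace_c0_seqs c0_seqs_subset_c_seqs c0_seqs_nonzero assms]
  show ?thesis
    by (intro conjI c c0 card_of_refl[THEN ordIso_imp_ordLeq] card_complex_le)
qed

end
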